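(* Let $n\ge 1$ be an integer and suppose that \[ B(\zeta)=\sigma\prod_{k=1}^n\frac{\zeta-z_k}{1-\overline{z_k}\zeta}, \] where $z_1,z_2,\dots,z_n\in\mathbb{D}$ and $\sigma\in\mathbb{T}$. If \[ \sum_{k=1}^n\frac{1-|z_k|}{1+|z_k|}\ge n-1, \qquad ( * ) \] then $\zeta\mapsto B(\zeta)/\zeta^{n-1}$ is a circle homeomorphism. In particular, this holds if $|z_k|\le\frac{1}{2n-1}$ for all $k$. If all numbers $z_k$ have the same argument, then condition $( * )$ is also necessary for $B(\zeta)/\zeta^{n-1}$ to be a circle homeomorphism.
   Context: $\mathbb{T}=\{z\in\mathbb{C}\colon |z|=1\}$ and $\mathbb{D}=\{z\in\mathbb{C}\colon |z|<1\}$. A circle homeomorphism is a homeomorphism of $\mathbb{T}$ onto itself; throughout, circle homeomorphisms are assumed sense-preserving. The function $B(\zeta)/\zeta^{n-1}$ is regarded as a function of $\zeta\in\mathbb{T}$. "All $z_k$ have the same argument" means that there is $\omega\in\mathbb{T}$ with $z_k=|z_k|\omega$ for every $k$. *)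

theory Defs
  imports "HOL-Analysis.Analysis"
begin

text \<open>A homeomorphism of the unit circle is sense-preserving if it has a continuous lift to
  the real line, with respect to the covering map \<^const>\<open>cis\<close>, that is strictly increasing.
  The values of \<open>f\<close> off the unit circle are irrelevant.\<close>

definition sense_preserving_on_circle :: "(complex \<Rightarrow> complex) \<Rightarrow> bool" where
  "sense_preserving_on_circle f \<longleftrightarrow>
     (\<exists>\<phi>::real \<Rightarrow> real. continuous_on UNIV \<phi> \<and> strict_mono \<phi> \<and> (\<forall>t. f (cis t) = cis (\<phi> t)))"

definition circle_homeomorphism :: "(complex \<Rightarrow> complex) \<Rightarrow> bool" where
  "circle_homeomorphism f \<longleftrightarrow>
     (\<exists>g. homeomorphism (sphere 0 1) (sphere 0 1) f g) \<and> sense_preserving_on_circle f"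

definition finite_blaschke :: "complex \<Rightarrow> nat \<Rightarrow> (nat \<Rightarrow> complex) \<Rightarrow> complex \<Rightarrow> complex" where
  "finite_blaschke \<sigma> n z \<zeta> = \<sigma> * (\<Prod>k=1..n. (\<zeta> - z k) / (1 - cnj (z k) * \<zeta>))"

end

theory Submission
  imports Defs
begin

text \<open>On the unit circle a Blaschke factor with zero \<open>a\<close> equals \<open>\<zeta> * cnj w / w\<close> with
  \<open>w = 1 - cnj a * \<zeta>\<close>. Since \<open>Re w > 0\<close>, its argument lifts to \<open>t - 2 arctan (Im w / Re w)\<close>,
  whose derivative is the Poisson kernel of \<open>a\<close>. The argument of the quotient thus has
  derivative \<open>\<Sum>\<^sub>k P\<^sub>k - (n - 1)\<close>, and \<open>P\<^sub>k\<close> has minimum \<open>(1 - |z\<^sub>k|) / (1 + |z\<^sub>k|)\<close>. Under the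
  sum condition the derivative is therefore nonnegative, and it cannot vanish on an interval:
  every \<open>P\<^sub>k\<close> would be minimal there, forcing all \<open>z\<^sub>k = 0\<close>, when the derivative is \<open>1\<close>.
  Conversely, for zeros on one ray all minima are attained at the same point, so a
  nondecreasing argument yields the sum condition.\<close>

section \<open>Lifted argument of a single Blaschke factor\<close>

definition blaschke_arg :: "complex \<Rightarrow> real \<Rightarrow> real" where
  "blaschke_arg a t = t - 2 * arctan (Im (1 - cnj a * cis t) / Re (1 - cnj a * cis t))"

lemma Re_one_minus_mult_cis_pos:
  assumes "norm a < 1"
  shows "Re (1 - cnj a * cis t) > 0"
proof -
  have "Re (cnj a * cis t) \<le> norm (cnj a * cis t)"
    by (rule complex_Re_le_cmod)
  also have "\<dots> < 1"
    using assms by (simp add: norm_mult)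
  finally show ?thesis by simp
qed

lemma one_minus_mult_cis_nonzero:
  assumes "norm a < 1"
  shows "1 - cnj a * cis t \<noteq> 0"
  using Re_one_minus_mult_cis_pos[OF assms, of t] by (metis less_irrefl zero_complex.sel(1))

text \<open>In the right half-plane \<open>arctan (Im w / Re w)\<close> is the argument of
  \<open>w\<close>, and dividing \<open>cnj w\<close> by \<open>w\<close> cancels the modulus and
  subtracts this argument twice.\<close>

lemma cis_minus_two_arctan:
  assumes "Re w > 0"
  shows "cis (- 2 * arctan (Im w / Re w)) = cnj w / w"
proof -
  define x where "x = Im w / Re w"
  have s: "sqrt (1 + x\<^sup>2) > 0"
    by (simp add: add_pos_nonneg)
  have w: "w = of_real (Re w * sqrt (1 + x\<^sup>2)) * cis (arctan x)"
    using assms s by (intro complex_eqI) (simp_all add: cos_arctan sin_arctan x_def)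
  define R where "R = Re w * sqrt (1 + x\<^sup>2)"
  have R: "R \<noteq> 0"
    using assms s by (simp add: R_def)
  have "cnj w / w = cis (- arctan x) / cis (arctan x)"
    by (subst (1 2) w) (use R in \<open>simp add: R_def[symmetric] cis_cnj\<close>)
  also have "\<dots> = cis (- 2 * arctan x)"
    by (simp add: cis_divide)
  finally show ?thesis
    by (simp add: x_def)
qed

lemma cis_blaschke_arg:
  assumes "norm a < 1"
  shows "cis (blaschke_arg a t) = (cis t - a) / (1 - cnj a * cis t)"
proof -
  let ?w = "1 - cnj a * cis t"
  have "cis (blaschke_arg a t) = cis t * cis (- 2 * arctan (Im ?w / Re ?w))"
    by (simp add: blaschke_arg_def cis_mult)
  also have "\<dots> = cis t * cnj ?w / ?w"
    by (subst cis_minus_two_arctan[OF Re_one_minus_mult_cis_pos[OF assms]]) simp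
  also have "cis t * cnj ?w = cis t - a"
    by (simp add: algebra_simps cis_cnj cis_mult)
  finally show ?thesis .
qed

text \<open>The \<open>arctan\<close> correction depends on \<open>t\<close> only through
  \<open>cis t\<close>, so the whole increment comes from the summand \<open>t\<close>.\<close>

lemma blaschke_arg_add_2pi: "blaschke_arg a (t + 2 * pi) = blaschke_arg a t + 2 * pi"
  by (simp add: blaschke_arg_def cis_mult[symmetric])

lemma blaschke_arg_has_derivative:
  assumes "norm a < 1"
  shows "(blaschke_arg a has_real_derivative
           (1 - (norm a)\<^sup>2) / (norm (1 - cnj a * cis t))\<^sup>2) (at t)"
proof -
  define x y where "x = Re a" and "y = Im a"
  define p where "p = (\<lambda>t. 1 - (x * cos t + y * sin t))"
  define q where "q = (\<lambda>t. y * cos t - x * sin t)"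
  have p_eq: "Re (1 - cnj a * cis t) = p t" and q_eq: "Im (1 - cnj a * cis t) = q t" for t
    by (simp_all add: p_def q_def x_def y_def)
  have p: "p t > 0"
    using Re_one_minus_mult_cis_pos[OF assms, of t] by (simp only: p_eq)
  have dp: "(p has_real_derivative - q t) (at t)"
    unfolding p_def q_def by (auto intro!: derivative_eq_intros)
  have dq: "(q has_real_derivative p t - 1) (at t)"
    unfolding p_def q_def by (auto intro!: derivative_eq_intros)
  have w2: "(norm (1 - cnj a * cis t))\<^sup>2 = (p t)\<^sup>2 + (q t)\<^sup>2"
    by (simp only: cmod_power2 p_eq q_eq)
  have sc: "(cos t)\<^sup>2 + (sin t)\<^sup>2 = 1"
    by simp
  \<comment> \<open>With \<open>w = 1 - cnj a * cis t\<close>, differentiating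
    \<open>arctan (q / p)\<close> leaves the numerator \<open>2 * Re w - (norm w)\<^sup>2\<close>.
    The terms in \<open>cnj a * cis t\<close> cancel in it, which makes it independent of
    \<open>t\<close>.\<close>
  have id: "2 * p t - ((p t)\<^sup>2 + (q t)\<^sup>2) = 1 - (norm a)\<^sup>2"
    unfolding p_def q_def cmod_power2 x_def[symmetric] y_def[symmetric]
    using sc by algebra
  have pq: "(p t)\<^sup>2 + (q t)\<^sup>2 > 0"
    using p by (simp add: add_pos_nonneg)
  have inv: "1 + (q t / p t)\<^sup>2 = ((p t)\<^sup>2 + (q t)\<^sup>2) / (p t)\<^sup>2"
    using p by (simp add: field_simps)
  have "((\<lambda>t. t - 2 * arctan (q t / p t)) has_real_derivative
          1 - 2 * (inverse (1 + (q t / p t)\<^sup>2) * (((p t - 1) * p t - q t * (- q t)) / (p t * p t)))) (at t)"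
    by (rule derivative_eq_intros dp dq refl | use p in force)+
  also have "1 - 2 * (inverse (1 + (q t / p t)\<^sup>2) * (((p t - 1) * p t - q t * (- q t)) / (p t * p t)))
      = (2 * p t - ((p t)\<^sup>2 + (q t)\<^sup>2)) / ((p t)\<^sup>2 + (q t)\<^sup>2)"
    unfolding inv using p pq by (simp add: divide_simps power2_eq_square) algebra
  finally show ?thesis
    by (simp only: id w2 blaschke_arg_def[abs_def] p_eq q_eq)
qed

section \<open>Minimum of the Poisson kernel and the case of equality\<close>

lemma poisson_kernel_ge:
  assumes "norm a < 1"
  shows "(1 - norm a) / (1 + norm a) \<le> (1 - (norm a)\<^sup>2) / (norm (1 - cnj a * cis t))\<^sup>2"
proof -
  let ?w = "1 - cnj a * cis t"
  have "norm ?w \<le> 1 + norm a"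
    using norm_triangle_ineq4[of 1 "cnj a * cis t"] by (simp add: norm_mult)
  moreover have "norm ?w > 0"
    using one_minus_mult_cis_nonzero[OF assms] by simp
  ultimately have "(1 - (norm a)\<^sup>2) / (1 + norm a)\<^sup>2 \<le> (1 - (norm a)\<^sup>2) / (norm ?w)\<^sup>2"
    using assms by (intro divide_left_mono mult_pos_pos power_mono)
       (auto simp: abs_square_le_1 add_pos_nonneg)
  moreover have "(1 - (norm a)\<^sup>2) / (1 + norm a)\<^sup>2 = (1 - norm a) / (1 + norm a)"
  proof -
    have "1 + norm a \<noteq> 0"
      by (metis add_pos_nonneg norm_ge_zero less_numeral_extra(1) less_irrefl)
    then show ?thesis
      by (simp add: divide_simps) (simp add: power2_eq_square algebra_simps)
  qed
  ultimately show ?thesis by simp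
qed

text \<open>Equality forces \<open>norm (1 - cnj a * cis t) = 1 + norm a\<close>; expanding the
  square isolates the real part of \<open>cnj a * cis t\<close>. It is written with
  \<open>cos\<close> and \<open>sin\<close> so that it can be differentiated in
  \<open>t\<close>.\<close>

lemma poisson_kernel_eq_min_imp:
  assumes "norm a < 1"
    and "(1 - (norm a)\<^sup>2) / (norm (1 - cnj a * cis t))\<^sup>2 = (1 - norm a) / (1 + norm a)"
  shows "Re a * cos t + Im a * sin t = - norm a"
proof -
  let ?w = "1 - cnj a * cis t"
  have w: "norm ?w > 0"
    using one_minus_mult_cis_nonzero[OF assms(1)] by simp
  have "(1 - norm a) * (1 + norm a)\<^sup>2 = (1 - norm a) * (norm ?w)\<^sup>2"
    using assms(2) w norm_ge_zero[of a]
    by (simp add: divide_simps power2_eq_square algebra_simps split: if_splits)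
  then have w2: "(norm ?w)\<^sup>2 = (1 + norm a)\<^sup>2"
    using assms(1) by simp
  have sc: "(cos t)\<^sup>2 + (sin t)\<^sup>2 = 1"
    by simp
  have "(1 - (Re a * cos t + Im a * sin t))\<^sup>2 + (Im a * cos t - Re a * sin t)\<^sup>2 =
      1 + ((Re a)\<^sup>2 + (Im a)\<^sup>2) - 2 * (Re a * cos t + Im a * sin t)"
    using sc by algebra
  then have "(norm ?w)\<^sup>2 = 1 + (norm a)\<^sup>2 - 2 * (Re a * cos t + Im a * sin t)"
    by (simp add: cmod_power2)
  with w2 show ?thesis
    by (simp add: power2_sum)
qed

lemma DERIV_zero_if_const_on_interval:
  fixes f :: "real \<Rightarrow> real"
  assumes "(f has_real_derivative D) (at u)" and "u \<in> {s<..<t}"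
    and "\<And>v. v \<in> {s<..<t} \<Longrightarrow> f v = c"
  shows "D = 0"
proof (rule DERIV_local_const[OF assms(1)])
  show "0 < min (u - s) (t - u)"
    using assms(2) by simp
  show "\<forall>v. \<bar>u - v\<bar> < min (u - s) (t - u) \<longrightarrow> f u = f v"
    using assms(2,3) by (auto simp: abs_less_iff)
qed

text \<open>The second derivative of the combination is its negative, while that of a constant is
  zero.\<close>

lemma cos_sin_combination_const_imp_zero:
  fixes x y c :: real
  assumes "s < t" and const: "\<And>u. u \<in> {s<..<t} \<Longrightarrow> x * cos u + y * sin u = c"
  shows "c = 0"
proof -
  have d1: "y * cos u - x * sin u = 0" if "u \<in> {s<..<t}" for u
  proof -
    have "((\<lambda>u. x * cos u + y * sin u) has_real_derivative y * cos u - x * sin u) (at u)"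
      by (auto intro!: derivative_eq_intros)
    then show ?thesis
      by (rule DERIV_zero_if_const_on_interval[OF _ that]) (rule const)
  qed
  obtain u where u: "u \<in> {s<..<t}"
    using dense[OF assms(1)] by auto
  have "((\<lambda>u. y * cos u - x * sin u) has_real_derivative - (x * cos u + y * sin u)) (at u)"
    by (auto intro!: derivative_eq_intros)
  then have "- (x * cos u + y * sin u) = 0"
    by (rule DERIV_zero_if_const_on_interval[OF _ u]) (rule d1)
  then show ?thesis
    using const[OF u] by simp
qed

section \<open>Lifts of circle maps\<close>

lemma lifts_differ_by_constant:
  fixes \<phi> \<psi> :: "real \<Rightarrow> real"
  assumes "continuous_on UNIV \<phi>" "continuous_on UNIV \<psi>" and eq: "\<And>t. cis (\<phi> t) = cis (\<psi> t)"
  obtains c where "\<And>t. \<psi> t = \<phi> t + c"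
proof -
  have int: "\<exists>m::int. \<psi> t - \<phi> t = 2 * pi * m" for t
    using eq[of t] sin_cos_eq_iff[of "\<psi> t" "\<phi> t"] 
    by (auto simp: complex_eq_iff)
  \<comment> \<open>The difference is continuous, and its distinct values, being multiples of
    \<open>2 * pi\<close>, are at least \<open>2 * pi\<close> apart.\<close>
  have "(\<lambda>t. \<psi> t - \<phi> t) constant_on UNIV"
  proof (rule continuous_discrete_range_constant)
    show "continuous_on UNIV (\<lambda>t. \<psi> t - \<phi> t)"
      using assms by (intro continuous_intros)
    show "\<exists>e>0. \<forall>y. y \<in> UNIV \<and> \<psi> y - \<phi> y \<noteq> \<psi> x - \<phi> x \<longrightarrow>
        e \<le> norm ((\<psi> y - \<phi> y) - (\<psi> x - \<phi> x))" for x
    proof (intro exI[of _ "2 * pi"] conjI allI impI)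
      fix y assume ne: "y \<in> UNIV \<and> \<psi> y - \<phi> y \<noteq> \<psi> x - \<phi> x"
      obtain k l :: int where kl: "\<psi> y - \<phi> y = 2 * pi * k" "\<psi> x - \<phi> x = 2 * pi * l"
        using int by metis
      with ne have "1 \<le> \<bar>k - l\<bar>" by auto
      then have "1 \<le> \<bar>real_of_int k - real_of_int l\<bar>" by linarith
      then show "2 * pi \<le> norm ((\<psi> y - \<phi> y) - (\<psi> x - \<phi> x))"
        unfolding kl by (simp add: right_diff_distrib[symmetric] abs_mult)
    qed simp
  qed simp
  then obtain c where "\<And>t. \<psi> t - \<phi> t = c"
    unfolding constant_on_def by auto
  then show ?thesis
    by (intro that[of c]) (simp add: algebra_simps)
qed

text \<open>Over one period the lift rises by exactly one full turn: strict growth then gives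
  injectivity, the intermediate value theorem surjectivity, and compactness of the circle continuity
  of the inverse.\<close>

lemma circle_homeomorphismI:
  assumes cont: "continuous_on (sphere 0 1) f"
    and \<phi>: "continuous_on UNIV \<phi>" "strict_mono \<phi>" "\<And>t. f (cis t) = cis (\<phi> t)"
    and per: "\<phi> (2 * pi) = \<phi> 0 + 2 * pi"
  shows "circle_homeomorphism f"
proof -
  have sphereE: "\<exists>t. 0 \<le> t \<and> t < 2 * pi \<and> w = cis t" if "w \<in> sphere 0 1" for w
    using that Arg2pi[of w] by (intro exI[of _ "Arg2pi w"]) (auto simp: is_Arg_def cis_conv_exp)
  have lt: "cis (\<phi> s) \<noteq> cis (\<phi> t)" if "0 \<le> s" "s < t" "t < 2 * pi" for s t
  proof
    assume "cis (\<phi> s) = cis (\<phi> t)"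
    then obtain m :: int where m: "\<phi> t = \<phi> s + 2 * pi * m"
      using sin_cos_eq_iff[of "\<phi> t" "\<phi> s"] by (auto simp: complex_eq_iff)
    have "\<phi> 0 \<le> \<phi> s" "\<phi> s < \<phi> t" "\<phi> t < \<phi> (2 * pi)"
      using that \<phi>(2) by (auto simp: strict_mono_less strict_mono_less_eq)
    then have "0 < 2 * pi * m" "2 * pi * m < 2 * pi * 1"
      using m per by linarith+
    then have "0 < m" "m < 1"
      by (simp_all add: zero_less_mult_iff)
    then show False by simp
  qed
  have "inj_on f (sphere 0 1)"
  proof (rule inj_onI)
    fix w w' assume "w \<in> sphere 0 1" "w' \<in> sphere 0 1" and "f w = f w'"
    moreover obtain s t where "0 \<le> s" "s < 2 * pi" "w = cis s" "0 \<le> t" "t < 2 * pi" "w' = cis t"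
      using sphereE calculation by metis
    ultimately show "w = w'"
      using lt[of s t] lt[of t s] \<phi>(3) by (cases s t rule: linorder_cases) auto
  qed
  moreover have "f ` sphere 0 1 = sphere 0 1"
  proof
    show "f ` sphere 0 1 \<subseteq> sphere 0 1"
      using sphereE \<phi>(3) by (metis image_subsetI norm_cis mem_sphere_0)
    show "sphere 0 1 \<subseteq> f ` sphere 0 1"
    proof
      fix w :: complex assume "w \<in> sphere 0 1"
      then obtain \<theta> where \<theta>: "w = cis \<theta>" using sphereE by blast
      \<comment> \<open>The number of full turns that moves \<open>\<theta>\<close> into the range
        of \<open>\<phi>\<close> over \<open>[0, 2 * pi]\<close>.\<close>
      define m where "m = \<lceil>(\<phi> 0 - \<theta>) / (2 * pi)\<rceil>"
      have "(\<phi> 0 - \<theta>) / (2 * pi) \<le> m" "m < (\<phi> 0 - \<theta>) / (2 * pi) + 1"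
        unfolding m_def by linarith+
      then have "\<phi> 0 \<le> \<theta> + 2 * pi * m" "\<theta> + 2 * pi * m \<le> \<phi> (2 * pi)"
        unfolding per by (simp_all add: field_simps)
      then obtain t where "\<phi> t = \<theta> + 2 * pi * m"
        using IVT'[of \<phi> 0 _ "2 * pi"] continuous_on_subset[OF \<phi>(1) subset_UNIV] by force
      then have "f (cis t) = w"
        using \<phi>(3)[of t] \<theta> by (simp add: cis_mult[symmetric])
      then show "w \<in> f ` sphere 0 1"
        by (intro image_eqI[of _ _ "cis t"]) auto
    qed
  qed
  ultimately obtain g where "homeomorphism (sphere 0 1) (sphere 0 1) f g"
    using homeomorphism_compact[OF compact_sphere cont] by blast
  then show ?thesis
    unfolding circle_homeomorphism_def sense_preserving_on_circle_def using \<phi> by blast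
qed

lemma cis_sum: "finite A \<Longrightarrow> cis (\<Sum>k\<in>A. f k) = (\<Prod>k\<in>A. cis (f k))"
  by (induction A rule: finite_induct) (simp_all add: cis_mult[symmetric])

section \<open>Lifted argument of the quotient\<close>

definition blaschke_quotient_arg :: "real \<Rightarrow> nat \<Rightarrow> (nat \<Rightarrow> complex) \<Rightarrow> real \<Rightarrow> real" where
  "blaschke_quotient_arg \<alpha> n z t = \<alpha> + (\<Sum>k=1..n. blaschke_arg (z k) t) - real (n - 1) * t"

context
  fixes n :: nat and z :: "nat \<Rightarrow> complex"
  assumes n: "n \<ge> 1" and z: "\<And>k. k \<in> {1..n} \<Longrightarrow> norm (z k) < 1"
begin

lemma cis_blaschke_quotient_arg:
  "finite_blaschke (cis \<alpha>) n z (cis t) / cis t ^ (n - 1) = cis (blaschke_quotient_arg \<alpha> n z t)"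
proof -
  have "(\<Prod>k=1..n. (cis t - z k) / (1 - cnj (z k) * cis t)) = cis (\<Sum>k=1..n. blaschke_arg (z k) t)"
    unfolding cis_sum[OF finite_atLeastAtMost]
    by (intro prod.cong refl) (simp only: cis_blaschke_arg z)
  then show ?thesis
    by (simp only: finite_blaschke_def blaschke_quotient_arg_def cis_mult cis_divide Complex.DeMoivre)
qed

text \<open>The \<open>n\<close> factors contribute \<open>n\<close> turns and the power in the
  denominator removes \<open>n - 1\<close>, so the quotient has degree one.\<close>

lemma blaschke_quotient_arg_2pi:
  "blaschke_quotient_arg \<alpha> n z (2 * pi) = blaschke_quotient_arg \<alpha> n z 0 + 2 * pi"
  using n blaschke_arg_add_2pi[of _ 0]
  by (simp add: blaschke_quotient_arg_def sum.distrib of_nat_diff algebra_simps)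

lemma blaschke_quotient_arg_has_derivative:
  "(blaschke_quotient_arg \<alpha> n z has_real_derivative
     (\<Sum>k=1..n. (1 - (norm (z k))\<^sup>2) / (norm (1 - cnj (z k) * cis t))\<^sup>2) - (real n - 1)) (at t)"
proof -
  have "((\<lambda>t. \<Sum>k=1..n. blaschke_arg (z k) t) has_real_derivative
     (\<Sum>k=1..n. (1 - (norm (z k))\<^sup>2) / (norm (1 - cnj (z k) * cis t))\<^sup>2)) (at t)"
    by (intro DERIV_sum blaschke_arg_has_derivative z)
  then show ?thesis
    unfolding blaschke_quotient_arg_def[abs_def]
    using n by (intro DERIV_cong[OF DERIV_diff[OF DERIV_add[OF DERIV_const] DERIV_cmult_Id]])
      (auto simp: of_nat_diff)
qed

lemma continuous_blaschke_quotient_arg: "continuous_on UNIV (blaschke_quotient_arg \<alpha> n z)"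
  by (meson DERIV_isCont blaschke_quotient_arg_has_derivative continuous_at_imp_continuous_on)

lemma strict_mono_blaschke_quotient_arg:
  assumes sum: "(\<Sum>k=1..n. (1 - norm (z k)) / (1 + norm (z k))) \<ge> real n - 1"
  shows "strict_mono (blaschke_quotient_arg \<alpha> n z)"
proof (rule ccontr)
  let ?\<phi> = "blaschke_quotient_arg \<alpha> n z"
  let ?P = "\<lambda>k t. (1 - (norm (z k))\<^sup>2) / (norm (1 - cnj (z k) * cis t))\<^sup>2"
  let ?m = "\<lambda>k. (1 - norm (z k)) / (1 + norm (z k))"
  have le: "?m k \<le> ?P k t" if "k \<in> {1..n}" for k t
    by (rule poisson_kernel_ge[OF z[OF that]])
  have sum_le: "(\<Sum>k=1..n. ?m k) \<le> (\<Sum>k=1..n. ?P k t)" for t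
    by (intro sum_mono le)
  have mono: "?\<phi> s \<le> ?\<phi> t" if "s \<le> t" for s t
  proof (rule DERIV_nonneg_imp_nondecreasing[OF that])
    fix u
    show "\<exists>y. (?\<phi> has_real_derivative y) (at u) \<and> 0 \<le> y"
      using blaschke_quotient_arg_has_derivative[of \<alpha> u] sum_le[of u] sum by fastforce
  qed
  assume "\<not> strict_mono ?\<phi>"
  then obtain s t where st: "s < t" "?\<phi> t \<le> ?\<phi> s"
    unfolding strict_mono_def by force
  \<comment> \<open>A nondecreasing function that fails to be strictly increasing is constant on
    some interval.\<close>
  have const: "?\<phi> u = ?\<phi> s" if "u \<in> {s<..<t}" for u
    using mono[of s u] mono[of u t] that st by auto
  have min: "?m k = ?P k u" if u: "u \<in> {s<..<t}" and k: "k \<in> {1..n}" for u k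
  proof -
    have "(\<Sum>k=1..n. ?P k u) - (real n - 1) = 0"
      by (rule DERIV_zero_if_const_on_interval[OF blaschke_quotient_arg_has_derivative u])
         (rule const)
    \<comment> \<open>The kernel sum equals \<open>n - 1\<close>, while the minima sum to at least
      \<open>n - 1\<close> and at most the kernel sum. Termwise inequality with equal sums then
      gives termwise equality.\<close>
    then have "(\<Sum>k=1..n. ?m k) = (\<Sum>k=1..n. ?P k u)"
      using sum sum_le[of u] by linarith
    then show ?thesis
      using sum_mono_inv[of ?m "{1..n}" "\<lambda>k. ?P k u"] le k by blast
  qed
  have "z k = 0" if k: "k \<in> {1..n}" for k
  proof -
    have "- norm (z k) = 0"
      using poisson_kernel_eq_min_imp[OF z[OF k]] min[OF _ k]
      by (intro cos_sin_combination_const_imp_zero[OF st(1), of "Re (z k)" "Im (z k)"]) metis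
    then show ?thesis by simp
  qed
  \<comment> \<open>With all zeros at the origin the quotient is a rotation, whose lift has slope
    \<open>n - (n - 1) = 1\<close>.\<close>
  then have "?\<phi> u = \<alpha> + u" for u
    using n by (simp add: blaschke_quotient_arg_def blaschke_arg_def of_nat_diff algebra_simps)
  with st show False by simp
qed

lemma circle_homeomorphism_blaschke_quotient:
  assumes "(\<Sum>k=1..n. (1 - norm (z k)) / (1 + norm (z k))) \<ge> real n - 1"
  shows "circle_homeomorphism (\<lambda>\<zeta>. finite_blaschke (cis \<alpha>) n z \<zeta> / \<zeta> ^ (n - 1))"
proof (rule circle_homeomorphismI)
  have "1 - cnj (z k) * \<zeta> \<noteq> 0" if "k \<in> {1..n}" "norm \<zeta> = 1" for k \<zeta>
  proof
    assume "1 - cnj (z k) * \<zeta> = 0"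
    then have "norm (cnj (z k) * \<zeta>) = 1" by simp
    with z[OF that(1)] that(2) show False by (simp add: norm_mult)
  qed
  then show "continuous_on (sphere 0 1) (\<lambda>\<zeta>. finite_blaschke (cis \<alpha>) n z \<zeta> / \<zeta> ^ (n - 1))"
    unfolding finite_blaschke_def by (intro continuous_intros) auto
qed (use continuous_blaschke_quotient_arg strict_mono_blaschke_quotient_arg[OF assms]
      cis_blaschke_quotient_arg blaschke_quotient_arg_2pi in auto)

text \<open>The function \<open>(1 - r) / (1 + r)\<close> decreases in \<open>r\<close> and equals
  \<open>(n - 1) / n\<close> at \<open>r = 1 / (2 * n - 1)\<close>, so each of the \<open>n\<close>
  terms contributes at least its equal share of \<open>n - 1\<close>.\<close>

lemma sum_ge_if_norm_le:
  assumes "\<And>k. k \<in> {1..n} \<Longrightarrow> norm (z k) \<le> 1 / (2 * real n - 1)"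
  shows "(\<Sum>k=1..n. (1 - norm (z k)) / (1 + norm (z k))) \<ge> real n - 1"
proof -
  have "(real n - 1) / real n \<le> (1 - norm (z k)) / (1 + norm (z k))" if "k \<in> {1..n}" for k
  proof -
    have "norm (z k) * (2 * real n - 1) \<le> 1"
      using assms[OF that] n by (simp add: pos_le_divide_eq)
    then have "(real n - 1) * (1 + norm (z k)) \<le> (1 - norm (z k)) * real n"
      by (simp add: algebra_simps)
    moreover have "real n > 0" "1 + norm (z k) > 0"
      using n norm_ge_zero[of "z k"] by linarith+
    ultimately show ?thesis
      by (simp add: pos_divide_le_eq pos_le_divide_eq)
  qed
  then have "(\<Sum>k=1..n. (real n - 1) / real n) \<le> (\<Sum>k=1..n. (1 - norm (z k)) / (1 + norm (z k)))"
    by (rule sum_mono)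
  then show ?thesis using n by simp
qed

text \<open>At the point \<open>- \<omega>\<close> all Poisson kernels attain their minimum simultaneously.\<close>

lemma sum_ge_if_circle_homeomorphism:
  assumes \<omega>: "norm \<omega> = 1" "\<And>k. k \<in> {1..n} \<Longrightarrow> z k = of_real (norm (z k)) * \<omega>"
    and "circle_homeomorphism (\<lambda>\<zeta>. finite_blaschke (cis \<alpha>) n z \<zeta> / \<zeta> ^ (n - 1))"
  shows "(\<Sum>k=1..n. (1 - norm (z k)) / (1 + norm (z k))) \<ge> real n - 1"
proof -
  let ?\<phi> = "blaschke_quotient_arg \<alpha> n z"
  obtain \<psi> :: "real \<Rightarrow> real" where \<psi>: "continuous_on UNIV \<psi>" "strict_mono \<psi>"
      "\<And>t. cis (?\<phi> t) = cis (\<psi> t)"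
    using assms(3)
    unfolding circle_homeomorphism_def sense_preserving_on_circle_def cis_blaschke_quotient_arg
    by auto
  \<comment> \<open>The hypothesis provides some increasing lift, not necessarily the explicit one;
    differing only by a constant, the explicit lift inherits its monotonicity.\<close>
  obtain c where c: "\<And>t. ?\<phi> t = \<psi> t + c"
    using lifts_differ_by_constant[OF \<psi>(1) continuous_blaschke_quotient_arg \<psi>(3)[symmetric]] by metis
  define t where "t = Arg (- \<omega>)"
  have t: "cis t = - \<omega>"
    using \<omega>(1) by (cases "\<omega> = 0") (simp_all add: t_def cis_Arg sgn_eq)
  have eq: "(1 - (norm (z k))\<^sup>2) / (norm (1 - cnj (z k) * cis t))\<^sup>2 = (1 - norm (z k)) / (1 + norm (z k))"
    if k: "k \<in> {1..n}" for k
  proof -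
    define r where "r = norm (z k)"
    have r: "r \<ge> 0" by (simp add: r_def)
    \<comment> \<open>At this point \<open>cnj (z k) * cis t\<close> is the negative real number
      \<open>- r\<close> (or zero), so the triangle inequality behind the lower bound is an
      equality.\<close>
    have "cnj (z k) * cis t = - (of_real r * (cnj \<omega> * \<omega>))"
      using \<omega>(2)[OF k] unfolding t r_def[symmetric] by simp
    also have "cnj \<omega> * \<omega> = 1"
      using \<omega>(1) by (metis complex_norm_square mult.commute of_real_1 power_one)
    finally have "norm (1 - cnj (z k) * cis t) = norm (of_real (1 + r) :: complex)"
      by simp
    also have "\<dots> = 1 + r"
      using r by (simp only: norm_of_real)
    finally show ?thesis
      unfolding r_def[symmetric] using r
      by (simp add: divide_simps) (simp add: power2_eq_square algebra_simps)
  qed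
  have "mono ?\<phi>"
    unfolding mono_def c using strict_mono_less_eq[OF \<psi>(2)] by simp
  then have "(\<Sum>k=1..n. (1 - (norm (z k))\<^sup>2) / (norm (1 - cnj (z k) * cis t))\<^sup>2) - (real n - 1) \<ge> 0"
    using blaschke_quotient_arg_has_derivative[of \<alpha> t]
    by (intro mono_on_imp_deriv_nonneg[of UNIV ?\<phi>]) auto
  with eq show ?thesis by simp
qed

end

theorem theorem5p1:
  fixes n :: nat and \<sigma> :: complex and z :: "nat \<Rightarrow> complex" and B :: "complex \<Rightarrow> complex"
  assumes "n \<ge> 1"
    and "\<sigma> \<in> sphere 0 1"
    and "\<And>k. k \<in> {1..n} \<Longrightarrow> z k \<in> ball 0 1"
    and "B = finite_blaschke \<sigma> n z"
  shows "((\<Sum>k=1..n. (1 - norm (z k)) / (1 + norm (z k))) \<ge> real n - 1 \<longrightarrow>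
           circle_homeomorphism (\<lambda>\<zeta>. B \<zeta> / \<zeta> ^ (n - 1)))
       \<and> ((\<forall>k\<in>{1..n}. norm (z k) \<le> 1 / (2 * real n - 1)) \<longrightarrow>
           circle_homeomorphism (\<lambda>\<zeta>. B \<zeta> / \<zeta> ^ (n - 1)))
       \<and> ((\<exists>\<omega>\<in>sphere 0 1. \<forall>k\<in>{1..n}. z k = of_real (norm (z k)) * \<omega>) \<longrightarrow>
           circle_homeomorphism (\<lambda>\<zeta>. B \<zeta> / \<zeta> ^ (n - 1)) \<longrightarrow>
           (\<Sum>k=1..n. (1 - norm (z k)) / (1 + norm (z k))) \<ge> real n - 1)"
proof -
  have z: "norm (z k) < 1" if "k \<in> {1..n}" for k
    using assms(3)[OF that] by simp
  \<comment> \<open>The preceding results take the unimodular factor in the form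
    \<open>cis \<alpha>\<close>; here \<open>\<alpha>\<close> is the principal argument of
    \<open>\<sigma>\<close>.\<close>
  have B: "B = finite_blaschke (cis (Arg \<sigma>)) n z"
    using assms(2,4) by (cases "\<sigma> = 0") (simp_all add: cis_Arg sgn_eq)
  show ?thesis
    unfolding B
  proof (intro conjI impI)
    show "circle_homeomorphism (\<lambda>\<zeta>. finite_blaschke (cis (Arg \<sigma>)) n z \<zeta> / \<zeta> ^ (n - 1))"
      if "(\<Sum>k=1..n. (1 - norm (z k)) / (1 + norm (z k))) \<ge> real n - 1"
      using assms(1) z that by (rule circle_homeomorphism_blaschke_quotient)
    show "circle_homeomorphism (\<lambda>\<zeta>. finite_blaschke (cis (Arg \<sigma>)) n z \<zeta> / \<zeta> ^ (n - 1))"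
      if "\<forall>k\<in>{1..n}. norm (z k) \<le> 1 / (2 * real n - 1)"
      using assms(1) z sum_ge_if_norm_le[OF assms(1) z bspec[OF that]]
      by (rule circle_homeomorphism_blaschke_quotient)
    assume "\<exists>\<omega>\<in>sphere 0 1. \<forall>k\<in>{1..n}. z k = of_real (norm (z k)) * \<omega>"
    then obtain \<omega> where \<omega>: "norm \<omega> = 1" "\<And>k. k \<in> {1..n} \<Longrightarrow> z k = of_real (norm (z k)) * \<omega>"
      unfolding Bex_def mem_sphere_0 by blast
    assume "circle_homeomorphism (\<lambda>\<zeta>. finite_blaschke (cis (Arg \<sigma>)) n z \<zeta> / \<zeta> ^ (n - 1))"
    with assms(1) z \<omega> show "real n - 1 \<le> (\<Sum>k=1..n. (1 - norm (z k)) / (1 + norm (z k)))"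
      by (rule sum_ge_if_circle_homeomorphism)
  qed
qed

end
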